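(* Let $n\in\mathbb{N}$ and let $a_1,\dots,a_m$ be distinct divisors of $n$. Suppose that for each pair $1\le i<j\le m$ one of the two indices $i,j$ is (arbitrarily) chosen and "assigned" the pair. For each $1\le i\le m$ define $$\mathrm{ch}(a_i)=\operatorname{lcm}\Big(\{1\}\cup\{\gcd(a_i,a_j): j\ne i,\ \text{the pair }\{i,j\}\text{ is assigned to }i\}\Big),$$ and let $H_i=\bigcup_{r=0}^{\mathrm{ch}(a_i)-1}(r+a_i\mathbb{Z}_n)$. Then $\{H_1,\dots,H_m\}$ is a non-disjoint $\big(n,m,\frac{n}{a_1}\mathrm{ch}(a_1),\dots,\frac{n}{a_m}\mathrm{ch}(a_m)\big)$-GPSEDF in $\mathbb{Z}_n$ with $\lambda_{i,j}=\frac{n}{a_ia_j}\mathrm{ch}(a_i)\mathrm{ch}(a_j)$ for $i\ne j$.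
   Context: For a divisor $a$ of $n$, $a\mathbb{Z}_n=\{0,a,2a,\dots,n-a\}$ denotes the additive subgroup of $\mathbb{Z}_n$ generated by $a$, and $r+S=\{r+s:s\in S\}$. (The quantity $\mathrm{ch}(a_i)$ is equivalently the final value of $\mathrm{chunk}(a_i)$ in the procedure: initialise $\mathrm{chunk}(a_i)=1$ for all $i$; for each pair $i<j$, choose $k\in\{i,j\}$ arbitrarily and set $\mathrm{chunk}(a_k):=\operatorname{lcm}(\mathrm{chunk}(a_k),\gcd(a_i,a_j))$.) For subsets $A,B$ of $\mathbb{Z}_n$, $\Delta(A,B)$ denotes the multiset $\{x-y:x\in A,y\in B\}$ (one entry per pair). A family of sets $\{A_1,\dots,A_m\}$ in $\mathbb{Z}_n$ with $|A_i|=k_i$ is a non-disjoint $(n,m,k_1,\dots,k_m)$-GPSEDF if for all $i\ne j$, $\Delta(A_i,A_j)$ contains every element of $\mathbb{Z}_n$ exactly $\lambda_{i,j}=k_ik_j/n$ times. *)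

theory Defs
  imports Complex_Main "HOL-Library.Multiset" "HOL-Algebra.Elementary_Groups"
begin

text \<open>
  The additive group of integers modulo \<open>n\<close> is \<^const>\<open>integer_mod_group\<close>: for \<open>n > 0\<close> its carrier
  is \<open>{0..<int n}\<close>. HOL-Algebra writes its operation multiplicatively.
\<close>

abbreviation Zn :: "nat \<Rightarrow> int monoid"
  where "Zn n \<equiv> integer_mod_group n"

text \<open>The reduction mod \<open>n\<close> in \<open>mult_subgroup\<close> only matters for \<open>a = n\<close>, which is the residue 0.\<close>

definition mult_subgroup :: "nat \<Rightarrow> nat \<Rightarrow> int set"
  where "mult_subgroup n a = generate (Zn n) {int a mod int n}"

definition diff_mset :: "nat \<Rightarrow> int set \<Rightarrow> int set \<Rightarrow> int multiset"
  where "diff_mset n A B =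
    image_mset (\<lambda>(x, y). x \<otimes>\<^bsub>Zn n\<^esub> inv\<^bsub>Zn n\<^esub> y) (mset_set (A \<times> B))"

text \<open>
  A family is indexed by \<open>{1..m}\<close>; repetitions and overlaps among its members are allowed. The
  parameters \<open>\<lambda>\<^sub>i\<^sub>j\<close> are real-valued so that \<open>k\<^sub>i k\<^sub>j / n\<close> is an exact quotient; equality with a
  multiplicity forces it to be a natural number.
\<close>

definition nondisjoint_GPSEDF ::
    "nat \<Rightarrow> nat \<Rightarrow> (nat \<Rightarrow> nat) \<Rightarrow> (nat \<Rightarrow> nat \<Rightarrow> real) \<Rightarrow> (nat \<Rightarrow> int set) \<Rightarrow> bool"
  where "nondisjoint_GPSEDF n m k lam A \<longleftrightarrow>
    (\<forall>i\<in>{1..m}. A i \<subseteq> carrier (Zn n) \<and> card (A i) = k i) \<and>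
    (\<forall>i\<in>{1..m}. \<forall>j\<in>{1..m}. i \<noteq> j \<longrightarrow>
       lam i j = real (k i) * real (k j) / real n \<and>
       (\<forall>d\<in>carrier (Zn n). real (count (diff_mset n (A i) (A j)) d) = lam i j))"

text \<open>\<open>asg {i, j}\<close> is the index to which the pair \<open>{i, j}\<close> is assigned.\<close>

definition ch :: "nat \<Rightarrow> (nat \<Rightarrow> nat) \<Rightarrow> (nat set \<Rightarrow> nat) \<Rightarrow> nat \<Rightarrow> nat"
  where "ch m a asg i =
    Lcm ({1} \<union> {gcd (a i) (a j) | j. j \<in> {1..m} \<and> j \<noteq> i \<and> asg {i, j} = i})"

definition H :: "nat \<Rightarrow> nat \<Rightarrow> (nat \<Rightarrow> nat) \<Rightarrow> (nat set \<Rightarrow> nat) \<Rightarrow> nat \<Rightarrow> int set"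
  where "H n m a asg i =
    (\<Union>r\<in>{0..<ch m a asg i}. int r <#\<^bsub>Zn n\<^esub> mult_subgroup n (a i))"

lemma mult_subgroup_eq:
  assumes "n > 0" and "a dvd n"
  shows "mult_subgroup n a = (\<lambda>t. int (t * a)) ` {0..<n div a}"
proof -
  interpret group "Zn n" by simp
  have "int a mod int n \<in> carrier (Zn n)"
    using assms by (simp add: carrier_integer_mod_group)
  then have "mult_subgroup n a = {(k * int a) mod int n | k. k \<in> (UNIV :: int set)}"
    unfolding mult_subgroup_def
    by (simp only: generate_pow int_pow_integer_mod_group mod_mult_right_eq)
  also have "\<dots> = (\<lambda>t. int (t * a)) ` {0..<n div a}"
  proof (intro equalityI subsetI)
    fix x assume "x \<in> {(k * int a) mod int n | k. k \<in> (UNIV :: int set)}"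
    then obtain k where k: "x = (k * int a) mod int n" by blast
    from assms obtain b where b: "n = a * b" by blast
    with assms have pos: "a > 0" "b > 0" by auto
    have "x = (k mod int b) * int a"
      by (metis k b mult.commute mult_mod_right of_nat_mult)
    moreover have "k mod int b \<ge> 0" using pos by simp
    ultimately have "x = int (nat (k mod int b) * a)" by (simp only: of_nat_mult int_nat_eq if_True)
    moreover have "nat (k mod int b) \<in> {0..<n div a}"
      using b pos by (simp add: nat_less_iff)
    ultimately show "x \<in> (\<lambda>t. int (t * a)) ` {0..<n div a}" by (rule image_eqI)
  next
    fix x assume "x \<in> (\<lambda>t. int (t * a)) ` {0..<n div a}"
    then obtain t where t: "x = int (t * a)" "t < n div a" by (metis (no_types, lifting) atLeastLessThan_iff imageE)
    from assms obtain b where b: "n = a * b" by blast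
    with assms have pos: "a > 0" "b > 0" by auto
    have "t * a < n" using t b pos by (simp add: mult.commute)
    then have "x = (int t * int a) mod int n" 
      by (metis t(1) mod_less of_nat_mod of_nat_mult)
    then show "x \<in> {(k * int a) mod int n | k. k \<in> (UNIV :: int set)}" by blast
  qed
  finally show ?thesis .
qed

end

theory Submission
  imports Defs
begin

text \<open>
  \<open>H\<^sub>i\<close> consists of the \<open>x \<in> {0..<n}\<close> with \<open>x mod a\<^sub>i < ch(a\<^sub>i)\<close>. A difference \<open>d\<close>
  therefore occurs as often as there are \<open>x\<close> whose residue mod \<open>a\<^sub>i\<close> lies in an interval of length
  \<open>ch(a\<^sub>i)\<close> while its residue mod \<open>a\<^sub>j\<close> lies in an interval (shifted by \<open>d\<close>) of length \<open>ch(a\<^sub>j)\<close>. By the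
  Chinese remainder theorem, each pair of residues that agrees mod \<open>g = gcd(a\<^sub>i, a\<^sub>j)\<close> is attained
  \<open>n / lcm(a\<^sub>i, a\<^sub>j)\<close> times, and other pairs never. The assignment makes \<open>g\<close> divide one of the
  two lengths, so the number of pairs agreeing mod \<open>g\<close> is \<open>ch(a\<^sub>i) ch(a\<^sub>j) / g\<close>, whatever \<open>d\<close> is.
\<close>

section \<open>Counting integers by their residues modulo one and two divisors of
  \<open>N\<close>\<close>

lemma card_residue_class:
  fixes N L z :: int
  assumes "N \<ge> 0" "L > 0" "L dvd N"
  shows "card {x\<in>{0..<N}. x mod L = z mod L} = nat (N div L)"
proof -
  obtain M where M: "N = L * M" using assms by blast
  have "M \<ge> 0" using assms M by (simp add: zero_le_mult_iff)
  have "{x\<in>{0..<N}. x mod L = z mod L} = (\<lambda>t. t * L + z mod L) ` {0..<M}"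
  proof (intro equalityI subsetI)
    fix x assume x: "x \<in> {x\<in>{0..<N}. x mod L = z mod L}"
    then have "x = (x div L) * L + z mod L" by (metis (lifting) div_mult_mod_eq mem_Collect_eq)
    moreover have "x div L < M"
    proof -
      have "x div L * L \<le> x" using assms by (simp add: minus_mod_eq_div_mult[symmetric])
      also have "x < M * L" using x M by (simp add: mult.commute)
      finally show ?thesis using assms by simp
    qed
    moreover have "x div L \<ge> 0" using x assms by (simp add: pos_imp_zdiv_nonneg_iff)
    ultimately show "x \<in> (\<lambda>t. t * L + z mod L) ` {0..<M}" by (metis atLeastLessThan_iff imageI)
  next
    fix x assume "x \<in> (\<lambda>t. t * L + z mod L) ` {0..<M}"
    then obtain t where t: "x = t * L + z mod L" "0 \<le> t" "t \<le> M - 1" by fastforce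
    \<comment> \<open>The bound \<open>M - 1\<close> instead of \<open>M\<close> leaves one full
      period \<open>L\<close> for the remainder \<open>z mod L\<close>.\<close>
    have "t * L \<le> (M - 1) * L" using t assms by (intro mult_right_mono) auto
    then have "t * L + L \<le> N" using M by (simp add: algebra_simps)
    moreover have "z mod L < L" "0 \<le> z mod L" "0 \<le> t * L" using t assms by auto
    ultimately have "x < N" "0 \<le> x" using t by linarith+
    then show "x \<in> {x\<in>{0..<N}. x mod L = z mod L}" using t by simp
  qed
  moreover have "inj_on (\<lambda>t. t * L + z mod L) {0..<M}" using assms by (simp add: inj_on_def)
  ultimately show ?thesis using M assms by (simp add: card_image)
qed

text \<open>Chinese remainder theorem for moduli that need not be coprime: compatible congruences
  merge into one modulo \<open>lcm a b\<close>, while any common solution forces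
  \<open>gcd a b\<close> to divide \<open>r - s\<close>.\<close>

lemma card_two_residue_classes:
  fixes N a b r s :: int
  assumes "N \<ge> 0" "a > 0" "b > 0" "a dvd N" "b dvd N"
  shows "card {x\<in>{0..<N}. x mod a = r mod a \<and> x mod b = s mod b} =
    (if gcd a b dvd r - s then nat (N div lcm a b) else 0)"
proof (cases "gcd a b dvd r - s")
  case True
  then obtain k where k: "r - s = gcd a b * k" by blast
  obtain u v where uv: "u * a + v * b = gcd a b" using bezout_int by blast
  \<comment> \<open>A simultaneous solution: by Bezout \<open>r - s = u * a * k + v * b * k\<close>,
    so moving \<open>r\<close> by a multiple of \<open>a\<close> lands on a translate of
    \<open>s\<close> by a multiple of \<open>b\<close>.\<close>
  define z where "z = r - u * a * k"
  have z2: "z = s + v * b * k" using k unfolding z_def uv[symmetric] by (simp add: algebra_simps)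
  have za: "a dvd z - r" and zb: "b dvd z - s" by (simp add: z_def, simp add: z2)
  have "x mod a = r mod a \<and> x mod b = s mod b \<longleftrightarrow> x mod lcm a b = z mod lcm a b" for x
  proof -
    have "r mod a = z mod a" "s mod b = z mod b" using za zb by (metis mod_eq_dvd_iff)+
    then have "x mod a = r mod a \<and> x mod b = s mod b \<longleftrightarrow> x mod a = z mod a \<and> x mod b = z mod b"
      by simp
    then show ?thesis by (simp add: mod_eq_dvd_iff)
  qed
  then show ?thesis using True assms card_residue_class[of N "lcm a b" z]
    by (simp add: lcm_pos_int)
next
  case False
  have "{x\<in>{0..<N}. x mod a = r mod a \<and> x mod b = s mod b} = {}"
  proof (rule equals0I)
    fix x assume "x \<in> {x\<in>{0..<N}. x mod a = r mod a \<and> x mod b = s mod b}"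
    then have "x mod a = r mod a \<and> x mod b = s mod b" by simp
    then have "gcd a b dvd x - r" "gcd a b dvd x - s"
      by (meson dvd_trans gcd_dvd1 gcd_dvd2 mod_eq_dvd_iff)+
    then have "gcd a b dvd (x - s) - (x - r)" by (rule dvd_diff[rotated])
    then show False using False by simp
  qed
  then show ?thesis using False by (simp only: card.empty if_False)
qed

text \<open>Sort the \<open>x\<close> by their pair of shifted residues. For a fixed first residue,
  the compatible second residues form one class modulo \<open>gcd a b\<close>; as
  \<open>gcd a b\<close> divides \<open>e\<close>, every such class meets \<open>{0..<e}\<close>
  equally often, so the shifts \<open>p\<close> and \<open>q\<close> drop out.\<close>

lemma card_two_residue_intervals:
  fixes N a b c e p q :: int
  assumes "N \<ge> 0" "a > 0" "b > 0" "a dvd N" "b dvd N"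
    and "0 \<le> c" "c \<le> a" "0 \<le> e" "e \<le> b" "gcd a b dvd e"
  shows "card {x\<in>{0..<N}. (x - p) mod a < c \<and> (x - q) mod b < e} =
    nat c * nat (e div gcd a b) * nat (N div lcm a b)"
proof -
  define S where "S = (\<lambda>(r, s). {x\<in>{0..<N}. x mod a = (r + p) mod a \<and> x mod b = (s + q) mod b})"
  \<comment> \<open>A number in \<open>{0..<k}\<close> is its own residue; \<open>c \<le> a\<close>
    and \<open>e \<le> b\<close> guarantee this for all residues in the two intervals.\<close>
  have shift: "(x - t) mod k = r \<longleftrightarrow> x mod k = (r + t) mod k" if "0 \<le> r" "r < k" for x t k r :: int
  proof -
    have "(x - t) mod k = r \<longleftrightarrow> (x - t) mod k = r mod k" using that by simp
    then show ?thesis by (simp add: mod_eq_dvd_iff algebra_simps)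
  qed
  have S: "S (r, s) = {x\<in>{0..<N}. (x - p) mod a = r \<and> (x - q) mod b = s}"
    if "(r, s) \<in> {0..<c} \<times> {0..<e}" for r s
    using that assms by (auto simp: S_def shift)
  have "{x\<in>{0..<N}. (x - p) mod a < c \<and> (x - q) mod b < e} = (\<Union>w\<in>{0..<c}\<times>{0..<e}. S w)"
  proof (intro equalityI subsetI)
    fix x assume x: "x \<in> {x\<in>{0..<N}. (x - p) mod a < c \<and> (x - q) mod b < e}"
    then have w: "((x - p) mod a, (x - q) mod b) \<in> {0..<c} \<times> {0..<e}" using assms by simp
    show "x \<in> (\<Union>w\<in>{0..<c}\<times>{0..<e}. S w)" using x by (intro UN_I[OF w]) (simp add: S[OF w])
  next
    fix x assume "x \<in> (\<Union>w\<in>{0..<c}\<times>{0..<e}. S w)"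
    then obtain r s where rs: "(r, s) \<in> {0..<c} \<times> {0..<e}" "x \<in> S (r, s)" by auto
    then show "x \<in> {x\<in>{0..<N}. (x - p) mod a < c \<and> (x - q) mod b < e}"
      unfolding S[OF rs(1)] by auto
  qed
  also have "card \<dots> = (\<Sum>w\<in>{0..<c}\<times>{0..<e}. card (S w))"
  proof (intro card_UN_disjoint ballI impI)
    fix w w' assume "w \<in> {0..<c}\<times>{0..<e}" "w' \<in> {0..<c}\<times>{0..<e}" "w \<noteq> w'"
    then show "S w \<inter> S w' = {}" by (cases w, cases w') (auto simp only: S)
  next
    show "finite (S w)" for w
      unfolding S_def by (cases w) (auto intro: finite_subset[of _ "{0..<N}"])
  qed simp
  also have "\<dots> = (\<Sum>r\<in>{0..<c}. \<Sum>s\<in>{0..<e}. card (S (r, s)))"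
    by (simp add: sum.cartesian_product)
  also have "\<dots> = (\<Sum>r\<in>{0..<c}. nat (e div gcd a b) * nat (N div lcm a b))"
  proof (intro sum.cong refl)
    fix r
    have "(\<Sum>s\<in>{0..<e}. card (S (r, s))) =
      (\<Sum>s\<in>{0..<e}. if s mod gcd a b = (r + p - q) mod gcd a b then nat (N div lcm a b) else 0)"
    proof (intro sum.cong refl)
      fix s
      \<comment> \<open>Compatibility solved for \<open>s\<close>: a single residue class, to which
        \<open>card_residue_class\<close> applies.\<close>
      have "gcd a b dvd (r + p) - (s + q) \<longleftrightarrow> s mod gcd a b = (r + p - q) mod gcd a b"
        by (subst eq_commute) (simp add: mod_eq_dvd_iff algebra_simps)
      then show "card (S (r, s)) =
        (if s mod gcd a b = (r + p - q) mod gcd a b then nat (N div lcm a b) else 0)"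
        using card_two_residue_classes[OF assms(1-5)] by (simp add: S_def)
    qed
    also have "\<dots> = card {s\<in>{0..<e}. s mod gcd a b = (r + p - q) mod gcd a b} * nat (N div lcm a b)"
      by (simp add: sum.If_cases Int_def)
    also have "\<dots> = nat (e div gcd a b) * nat (N div lcm a b)"
      using assms by (subst card_residue_class) auto
    finally show "(\<Sum>s\<in>{0..<e}. card (S (r, s))) = nat (e div gcd a b) * nat (N div lcm a b)" .
  qed
  finally show ?thesis by simp
qed

text \<open>Either length may be the one divisible by the gcd, matching the free choice in the
  assignment. The formula is symmetric, so the second case follows by exchanging the two
  moduli.\<close>

lemma real_card_two_residue_intervals:
  fixes n a b c e :: nat and p q :: int
  assumes "n > 0" "a dvd n" "b dvd n" "c \<le> a" "e \<le> b" "gcd a b dvd c \<or> gcd a b dvd e"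
  shows "real (card {x\<in>{0..<int n}. (x - p) mod int a < int c \<and> (x - q) mod int b < int e}) =
    real n / (real a * real b) * real c * real e"
proof -
  have main: "real (card {x\<in>{0..<int n}. (x - p) mod int a < int c \<and> (x - q) mod int b < int e}) =
      real n / (real a * real b) * real c * real e"
    if "a dvd n" "b dvd n" "c \<le> a" "e \<le> b" "gcd a b dvd e" for a b c e :: nat and p q :: int
  proof -
    have pos: "a > 0" "b > 0" using that \<open>n > 0\<close> by (auto intro: dvd_pos_nat)
    have "card {x\<in>{0..<int n}. (x - p) mod int a < int c \<and> (x - q) mod int b < int e} =
        c * (e div gcd a b) * (n div lcm a b)"
      using that pos by (subst card_two_residue_intervals)
        (simp_all flip: of_nat_div)
    \<comment> \<open>This identity removes gcd and lcm from the product of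
      \<open>e / gcd a b\<close> and \<open>n / lcm a b\<close>.\<close>
    moreover have "real (gcd a b) * real (lcm a b) = real a * real b"
      by (metis of_nat_mult prod_gcd_lcm_nat)
    moreover have "real (e div gcd a b) = real e / real (gcd a b)"
      "real (n div lcm a b) = real n / real (lcm a b)"
      using that by (auto intro!: real_of_nat_div lcm_least)
    ultimately show ?thesis by (simp add: field_simps)
  qed
  from assms(6) show ?thesis
  proof
    assume "gcd a b dvd e"
    then show ?thesis using assms main by blast
  next
    assume "gcd a b dvd c"
    then have "gcd b a dvd c" by (simp add: gcd.commute)
    from main[OF assms(3,2,5,4) this, of q p] show ?thesis
      by (simp add: conj_commute mult.commute mult.left_commute)
  qed
qed

section \<open>Multiplicities of differences in the integers modulo \<open>n\<close>\<close>

lemma count_diff_mset: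
  assumes "n > 0" "A \<subseteq> carrier (Zn n)" "B \<subseteq> carrier (Zn n)" "d \<in> carrier (Zn n)"
  shows "count (diff_mset n A B) d = card {x\<in>A. (x - d) mod int n \<in> B}"
proof -
  have carr: "carrier (Zn n) = {0..<int n}" using assms by (simp add: carrier_integer_mod_group)
  have fin: "finite A" "finite B" using assms(2,3) unfolding carr by (auto intro: finite_subset)
  have diff: "x \<otimes>\<^bsub>Zn n\<^esub> inv\<^bsub>Zn n\<^esub> y = d \<longleftrightarrow> y = (x - d) mod int n" if "x \<in> A" "y \<in> B" for x y
  proof -
    have y: "y \<in> carrier (Zn n)" "0 \<le> y" "y < int n" and d: "0 \<le> d" "d < int n"
      using that assms carr by auto
    have "x \<otimes>\<^bsub>Zn n\<^esub> inv\<^bsub>Zn n\<^esub> y = (x - y) mod int n"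
      using y by (simp add: inv_integer_mod_group mult_integer_mod_group mod_simps)
    then have "x \<otimes>\<^bsub>Zn n\<^esub> inv\<^bsub>Zn n\<^esub> y = d \<longleftrightarrow> (x - y) mod int n = d mod int n"
      using d by simp
    also have "\<dots> \<longleftrightarrow> (x - d) mod int n = y mod int n"
      by (simp add: mod_eq_dvd_iff algebra_simps)
    finally show ?thesis using y by auto
  qed
  have "count (diff_mset n A B) d =
      card {w \<in> A \<times> B. (case w of (x, y) \<Rightarrow> x \<otimes>\<^bsub>Zn n\<^esub> inv\<^bsub>Zn n\<^esub> y) = d}"
    unfolding diff_mset_def using fin
    by (simp add: count_image_mset' eq_commute[of d] conj_commute)
  \<comment> \<open>The difference \<open>d\<close> and the first entry determine the second, so
    these pairs form a graph over part of \<open>A\<close>.\<close>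
  also have "{w \<in> A \<times> B. (case w of (x, y) \<Rightarrow> x \<otimes>\<^bsub>Zn n\<^esub> inv\<^bsub>Zn n\<^esub> y) = d} =
      (\<lambda>x. (x, (x - d) mod int n)) ` {x\<in>A. (x - d) mod int n \<in> B}"
  proof (intro equalityI subsetI)
    fix w assume w: "w \<in> {w \<in> A \<times> B. (case w of (x, y) \<Rightarrow> x \<otimes>\<^bsub>Zn n\<^esub> inv\<^bsub>Zn n\<^esub> y) = d}"
    obtain x y where xy: "w = (x, y)" by (cases w)
    with w have "x \<in> A" "y \<in> B" "y = (x - d) mod int n" using diff[of x y] by simp_all
    then show "w \<in> (\<lambda>x. (x, (x - d) mod int n)) ` {x\<in>A. (x - d) mod int n \<in> B}"
      unfolding xy by blast
  next
    fix w assume "w \<in> (\<lambda>x. (x, (x - d) mod int n)) ` {x\<in>A. (x - d) mod int n \<in> B}"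
    then obtain x where "w = (x, (x - d) mod int n)" "x \<in> A" "(x - d) mod int n \<in> B" by blast
    then show "w \<in> {w \<in> A \<times> B. (case w of (x, y) \<Rightarrow> x \<otimes>\<^bsub>Zn n\<^esub> inv\<^bsub>Zn n\<^esub> y) = d}"
      using diff[of x "(x - d) mod int n"] by (simp del: mult_integer_mod_group)
  qed
  also have "card \<dots> = card {x\<in>A. (x - d) mod int n \<in> B}"
    by (simp add: card_image inj_on_def)
  finally show ?thesis .
qed

section \<open>Divisibility of \<open>ch\<close>, and \<open>H\<close> as an interval of
  residues\<close>

lemma ch_dvd: "ch m a asg i dvd a i"
  unfolding ch_def by (rule Lcm_least) auto

lemma gcd_dvd_ch:
  assumes "j \<in> {1..m}" "j \<noteq> i" "asg {i, j} = i"
  shows "gcd (a i) (a j) dvd ch m a asg i"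
  unfolding ch_def using assms by (intro dvd_Lcm) auto

lemma H_eq:
  assumes "n > 0" "a i dvd n"
  shows "H n m a asg i = {x\<in>{0..<int n}. x mod int (a i) < int (ch m a asg i)}"
proof -
  define c where "c = ch m a asg i"
  obtain M where M: "n = a i * M" using assms by blast
  have pos: "a i > 0" "M > 0" using assms M by auto
  have c: "c \<le> a i" unfolding c_def using pos ch_dvd dvd_imp_le by blast
  \<comment> \<open>Since \<open>c \<le> a i\<close>, adding \<open>r\<close> to an element of the
    subgroup never wraps around modulo \<open>n\<close>, and \<open>r\<close> stays the residue
    modulo \<open>a i\<close>.\<close>
  have lt: "t * a i + r < n" if "t < M" "r < c" for t r
  proof -
    have "t * a i + r < Suc t * a i" using that c by simp
    also have "\<dots> \<le> M * a i" using that by (intro mult_right_mono) auto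
    finally show ?thesis using M by (simp add: mult.commute)
  qed
  have "H n m a asg i = (\<Union>r\<in>{0..<c}. \<Union>t\<in>{0..<M}. {int (t * a i + r)})"
  proof -
    have "(int r + int (t * a i)) mod int n = int (t * a i + r)" if "t < M" "r < c" for t r
      using lt[OF that] by (simp add: add.commute flip: of_nat_add of_nat_mod of_nat_mult)
    then show ?thesis
      unfolding H_def mult_subgroup_eq[OF assms] l_coset_def c_def[symmetric]
      using M pos by (simp add: mult_integer_mod_group del: of_nat_mult of_nat_add)
  qed
  also have "\<dots> = {x\<in>{0..<int n}. x mod int (a i) < int c}"
  proof (intro equalityI subsetI)
    fix x assume "x \<in> (\<Union>r\<in>{0..<c}. \<Union>t\<in>{0..<M}. {int (t * a i + r)})"
    then obtain r t where rt: "x = int (t * a i + r)" "r < c" "t < M" by auto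
    then have "x mod int (a i) = int r" using c by (simp add: mod_pos_pos_trivial)
    then show "x \<in> {x\<in>{0..<int n}. x mod int (a i) < int c}" using rt lt[OF rt(3,2)]
      by (simp del: of_nat_add of_nat_mult)
  next
    fix x assume "x \<in> {x\<in>{0..<int n}. x mod int (a i) < int c}"
    then obtain y where y: "x = int y" "y < n" "y mod a i < c"
      by (cases x rule: int_cases2) (auto simp flip: of_nat_mod)
    then have "y div a i < M" using M by (simp add: less_mult_imp_div_less mult.commute)
    then show "x \<in> (\<Union>r\<in>{0..<c}. \<Union>t\<in>{0..<M}. {int (t * a i + r)})"
      using y by (intro UN_I[of "y mod a i"] UN_I[of "y div a i"]) auto
  qed
  finally show ?thesis unfolding c_def .
qed

theorem theorem4p9:
  fixes n m :: nat and a :: "nat \<Rightarrow> nat" and asg :: "nat set \<Rightarrow> nat"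
  assumes "n \<ge> 1"
    and "\<And>i. i \<in> {1..m} \<Longrightarrow> a i dvd n"
    and "inj_on a {1..m}"
    and "\<And>i j. 1 \<le> i \<Longrightarrow> i < j \<Longrightarrow> j \<le> m \<Longrightarrow> asg {i, j} \<in> {i, j}"
  shows "nondisjoint_GPSEDF n m
    (\<lambda>i. n div a i * ch m a asg i)
    (\<lambda>i j. real n / (real (a i) * real (a j)) * real (ch m a asg i) * real (ch m a asg j))
    (H n m a asg)"
proof -
  have n: "n > 0" using assms(1) by simp
  have carr: "carrier (Zn n) = {0..<int n}" using n by (simp add: carrier_integer_mod_group)
  have H: "H n m a asg i = {x\<in>{0..<int n}. x mod int (a i) < int (ch m a asg i)}"
    if "i \<in> {1..m}" for i
    using n assms(2)[OF that] by (rule H_eq)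
  have sub: "H n m a asg i \<subseteq> carrier (Zn n)" if "i \<in> {1..m}" for i
    using H[OF that] carr by auto
  have le: "ch m a asg i \<le> a i" if "i \<in> {1..m}" for i
    using assms(2)[OF that] n by (intro dvd_imp_le ch_dvd) (auto intro: dvd_pos_nat)
  have real_k: "real (n div a i) = real n / real (a i)" if "i \<in> {1..m}" for i
    using assms(2)[OF that] by (rule real_of_nat_div)
  show ?thesis
    unfolding nondisjoint_GPSEDF_def
  proof (intro conjI ballI impI)
    fix i assume i: "i \<in> {1..m}"
    show "H n m a asg i \<subseteq> carrier (Zn n)" using sub[OF i] .
    \<comment> \<open>The size is the two-modulus count with second modulus and length both 1, where
      the second condition always holds.\<close>
    have "real (card (H n m a asg i)) = real n / real (a i) * real (ch m a asg i)"
      using real_card_two_residue_intervals[of n "a i" 1 "ch m a asg i" 1 0 0] n assms(2)[OF i] le[OF i]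
      unfolding H[OF i] by simp
    then have "real (card (H n m a asg i)) = real (n div a i * ch m a asg i)"
      using real_k[OF i] by simp
    then show "card (H n m a asg i) = n div a i * ch m a asg i" by (simp only: of_nat_eq_iff)
  next
    fix i j assume ij: "i \<in> {1..m}" "j \<in> {1..m}" "i \<noteq> j"
    show "real n / (real (a i) * real (a j)) * real (ch m a asg i) * real (ch m a asg j) =
      real (n div a i * ch m a asg i) * real (n div a j * ch m a asg j) / real n"
      using real_k ij n by simp
  next
    fix i j d assume ij: "i \<in> {1..m}" "j \<in> {1..m}" "i \<noteq> j" and d: "d \<in> carrier (Zn n)"
    have "asg {i, j} = i \<or> asg {i, j} = j"
      using assms(4)[of i j] assms(4)[of j i] ij by (cases "i < j") (auto simp: insert_commute)
    then have "gcd (a i) (a j) dvd ch m a asg i \<or> gcd (a i) (a j) dvd ch m a asg j"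
      using gcd_dvd_ch[of j m i asg a] gcd_dvd_ch[of i m j asg a] ij
      by (auto simp: insert_commute gcd.commute)
    \<comment> \<open>The form \<open>x - 0\<close> fits the count with shifts 0 and
      \<open>d\<close>. The reduction modulo \<open>n\<close> disappears because \<open>a j\<close>
      divides \<open>n\<close>.\<close>
    moreover have "count (diff_mset n (H n m a asg i) (H n m a asg j)) d =
        card {x\<in>{0..<int n}. (x - 0) mod int (a i) < int (ch m a asg i) \<and>
          (x - d) mod int (a j) < int (ch m a asg j)}"
    proof -
      have "(x - d) mod int n mod int (a j) = (x - d) mod int (a j)" for x
        using assms(2)[OF ij(2)] by (simp add: mod_mod_cancel)
      then show ?thesis
        using n ij d sub by (simp add: count_diff_mset H conj_assoc)
    qed
    ultimately show "real (count (diff_mset n (H n m a asg i) (H n m a asg j)) d) =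
      real n / (real (a i) * real (a j)) * real (ch m a asg i) * real (ch m a asg j)"
      using real_card_two_residue_intervals[OF n assms(2)[OF ij(1)] assms(2)[OF ij(2)] le[OF ij(1)] le[OF ij(2)]]
      by presburger
  qed
qed

end
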